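(* Let $(X,d)$ be a metric space with positive Hausdorff dimension and let $0<r<1$. Then the $r$-snowflake $(X,d^r)$ of $(X,d)$ does not admit an isometric embedding into euclidean space; that is, there is no $k$ and no map $f:X\to\mathbb{R}^k$ such that $\|f(x)-f(x')\| = d(x,x')^r$ for all $x,x'\in X$.
   Context: Euclidean space means $\mathbb{R}^k$ (for some $k$) equipped with the standard euclidean metric, with $\|\cdot\|$ the euclidean norm. For $0<r<1$, the $r$-snowflake of a metric space $(X,d)$ is the metric space $(X,d^r)$, where $d^r(x,x')=d(x,x')^r$. The Hausdorff dimension of $(X,d)$ is taken with respect to the metric $d$. *)

theory Defs
  imports "HOL-Analysis.Analysis"
begin

subsection \<open>Hausdorff dimension of a metric space given by a carrier and a distance function\<close>

text \<open>The diameter is taken in the extended reals: the supremum of an unbounded set of reals,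
  and hence the library's real-valued diameter of an unbounded set, is unspecified.\<close>

definition ediam :: "('a \<Rightarrow> 'a \<Rightarrow> real) \<Rightarrow> 'a set \<Rightarrow> ennreal" where
  "ediam d U = (SUP x\<in>U. SUP y\<in>U. ennreal (d x y))"

text \<open>The \<open>s\<close>-th power of the diameter, for sets of finite diameter (\<open>enn2real\<close> maps infinity
  to \<open>0\<close>, but only sets of finite diameter are admitted in coverings below). The empty set has
  weight \<open>0\<close> for every \<open>s\<close>, and a nonempty set has weight \<open>1\<close> for \<open>s = 0\<close>; the latter needs a
  separate case because \<open>0 powr 0 = 0\<close> in the library.\<close>

definition diam_pow :: "('a \<Rightarrow> 'a \<Rightarrow> real) \<Rightarrow> real \<Rightarrow> 'a set \<Rightarrow> ennreal" where
  "diam_pow d s U =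
     (if U = {} then 0 else if s = 0 then 1 else ennreal (enn2real (ediam d U) powr s))"

text \<open>Finite coverings are included among the sequences since the members may be empty.\<close>

definition delta_covers :: "'a set \<Rightarrow> ('a \<Rightarrow> 'a \<Rightarrow> real) \<Rightarrow> real \<Rightarrow> (nat \<Rightarrow> 'a set) set" where
  "delta_covers X d \<delta> =
     {U. (\<forall>i. U i \<subseteq> X \<and> ediam d (U i) \<le> ennreal \<delta>) \<and> X \<subseteq> (\<Union>i. U i)}"

definition hausdorff_premeasure :: "'a set \<Rightarrow> ('a \<Rightarrow> 'a \<Rightarrow> real) \<Rightarrow> real \<Rightarrow> real \<Rightarrow> ennreal" where
  "hausdorff_premeasure X d s \<delta> = (INF U\<in>delta_covers X d \<delta>. \<Sum>i. diam_pow d s (U i))"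

definition hausdorff_measure :: "'a set \<Rightarrow> ('a \<Rightarrow> 'a \<Rightarrow> real) \<Rightarrow> real \<Rightarrow> ennreal" where
  "hausdorff_measure X d s = (SUP \<delta>\<in>{0<..}. hausdorff_premeasure X d s \<delta>)"

definition hausdorff_dim :: "'a set \<Rightarrow> ('a \<Rightarrow> 'a \<Rightarrow> real) \<Rightarrow> ennreal" where
  "hausdorff_dim X d = (INF s\<in>{s. 0 \<le> s \<and> hausdorff_measure X d s = 0}. ennreal s)"

subsection \<open>Snowflakes, euclidean space and isometric embeddings\<close>

definition snowflake :: "real \<Rightarrow> ('a \<Rightarrow> 'a \<Rightarrow> real) \<Rightarrow> 'a \<Rightarrow> 'a \<Rightarrow> real" where
  "snowflake r d = (\<lambda>x y. d x y powr r)"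

text \<open>The dimension \<open>k\<close> is a natural number, \<open>k = 0\<close> included. The points of
  \<open>\<real>\<^sup>k\<close> are the elements of \<open>topspace (Euclidean_space k)\<close>, i.e. the real sequences
  vanishing from index \<open>k\<close> on; the metric is the one induced by the euclidean norm.\<close>

definition euclidean_norm :: "nat \<Rightarrow> (nat \<Rightarrow> real) \<Rightarrow> real" where
  "euclidean_norm k v = L2_set v {..<k}"

definition euclidean_dist :: "nat \<Rightarrow> (nat \<Rightarrow> real) \<Rightarrow> (nat \<Rightarrow> real) \<Rightarrow> real" where
  "euclidean_dist k v w = euclidean_norm k (\<lambda>i. v i - w i)"

definition isometric_embedding ::
  "'a set \<Rightarrow> ('a \<Rightarrow> 'a \<Rightarrow> real) \<Rightarrow> 'b set \<Rightarrow> ('b \<Rightarrow> 'b \<Rightarrow> real) \<Rightarrow> ('a \<Rightarrow> 'b) \<Rightarrow> bool" where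
  "isometric_embedding X d Y e f \<longleftrightarrow>
     f \<in> X \<rightarrow> Y \<and> (\<forall>x\<in>X. \<forall>x'\<in>X. e (f x) (f x') = d x x')"

lemma powr_add_le:
  fixes a b r :: real
  assumes "0 \<le> a" "0 \<le> b" "0 < r" "r \<le> 1"
  shows "(a + b) powr r \<le> a powr r + b powr r"
proof (cases "a + b = 0")
  case True
  then show ?thesis using assms by simp
next
  case False
  then have pos: "a + b > 0" using assms by linarith
  have le: "t \<le> t powr r" if "0 \<le> t" "t \<le> 1" for t :: real
    using powr_mono'[of r 1 t] that assms by (cases "t = 0") auto
  have "1 = a / (a + b) + b / (a + b)"
    using pos by (simp flip: add_divide_distrib)
  also have "\<dots> \<le> (a / (a + b)) powr r + (b / (a + b)) powr r"
    using pos assms by (intro add_mono le) (auto simp: field_simps)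
  also have "\<dots> = (a powr r + b powr r) / (a + b) powr r"
    using pos assms by (simp add: powr_divide add_divide_distrib)
  finally show ?thesis
    using pos by (simp add: field_simps)
qed

lemma Metric_space_snowflake:
  assumes "Metric_space X d" "0 < r" "r < 1"
  shows "Metric_space X (snowflake r d)"
proof -
  interpret Metric_space X d by fact
  show ?thesis
  proof
    fix x y z assume *: "x \<in> X" "y \<in> X" "z \<in> X"
    have "d x z powr r \<le> (d x y + d y z) powr r"
      using * assms by (intro powr_mono2 triangle) auto
    also have "\<dots> \<le> d x y powr r + d y z powr r"
      using assms by (intro powr_add_le) auto
    finally show "snowflake r d x z \<le> snowflake r d x y + snowflake r d y z"
      by (simp add: snowflake_def)
  qed (use commute in \<open>auto simp: snowflake_def\<close>)
qed

lemma Metric_space_Euclidean_space: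
  "Metric_space (topspace (Euclidean_space k)) (euclidean_dist k)"
proof
  fix x y z :: "nat \<Rightarrow> real"
  show "0 \<le> euclidean_dist k x y"
    by (simp add: euclidean_dist_def euclidean_norm_def)
  show "euclidean_dist k x y = euclidean_dist k y x"
    by (simp add: euclidean_dist_def euclidean_norm_def L2_set_def power2_commute)
  show "euclidean_dist k x z \<le> euclidean_dist k x y + euclidean_dist k y z"
    using L2_set_triangle_ineq[of "\<lambda>i. x i - y i" "\<lambda>i. y i - z i" "{..<k}"]
    by (simp add: euclidean_dist_def euclidean_norm_def)
  assume "x \<in> topspace (Euclidean_space k)" "y \<in> topspace (Euclidean_space k)"
  then have "x i = y i" if "i \<ge> k" for i
    using that by (simp add: topspace_Euclidean_space)
  then have "(\<forall>i<k. x i = y i) \<longleftrightarrow> x = y"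
    by (metis ext not_le)
  then show "euclidean_dist k x y = 0 \<longleftrightarrow> x = y"
    by (simp add: euclidean_dist_def euclidean_norm_def L2_set_eq_0_iff Ball_def)
qed

end

theory Submission
  imports Defs
begin

text \<open>With \<open>p = 1 / r\<close>, the image \<open>Y\<close> of an embedding satisfies
  \<open>\<parallel>x - y\<parallel>\<^sup>p \<le> \<parallel>x - z\<parallel>\<^sup>p + \<parallel>z - y\<parallel>\<^sup>p\<close>. If \<open>x\<close> and \<open>z\<close> lie in nearly the same direction from \<open>y\<close>
  and \<open>b = \<parallel>z - y\<parallel>\<close> is much smaller than \<open>a = \<parallel>x - y\<parallel>\<close>, then \<open>\<parallel>x - z\<parallel> \<le> a - b / 2\<close>, so the left-hand
  side exceeds \<open>\<parallel>x - z\<parallel>\<^sup>p\<close> by an amount of order \<open>a\<^sup>p\<^sup>-\<^sup>1 b\<close>, which is larger than \<open>b\<^sup>p\<close>. By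
  compactness of the set of directions, such \<open>x\<close> and \<open>z\<close> exist near any accumulation point \<open>y\<close> of
  \<open>Y\<close>. Hence \<open>Y\<close> is discrete, so \<open>X\<close> is countable and has Hausdorff dimension zero.\<close>

text \<open>With \<open>t = b / a\<close>, dividing \<open>le\<close> by \<open>a powr p\<close>
  gives 1 \<le> (1 - t/2)^p + t^p \<le> 1 - t/2 + t^p, since p > 1 and 1 - t/2 lies in [0, 1]. Hence
  t/2 \<le> t^p, and cancelling t bounds the ratio from below.\<close>

lemma half_le_ratio_powr:
  fixes a b c p :: real
  assumes "1 < p" "0 < b" "b \<le> a" "0 \<le> c" "c \<le> a - b / 2"
    and le: "a powr p \<le> c powr p + b powr p"
  shows "1 / 2 \<le> (b / a) powr (p - 1)"
proof -
  define t where "t = b / a"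
  have t: "0 < t" "t \<le> 1" and a: "0 < a"
    using assms by (auto simp: t_def)
  have "a * (1 - t / 2) = a - b / 2"
    using a by (simp add: t_def right_diff_distrib)
  then have "c powr p \<le> (a * (1 - t / 2)) powr p"
    using assms by (intro powr_mono2) auto
  also have "\<dots> = a powr p * (1 - t / 2) powr p"
    using a t by (simp add: powr_mult)
  also have "\<dots> \<le> a powr p * (1 - t / 2)"
    using powr_mono'[of 1 p "1 - t / 2"] t assms(1) by (intro mult_left_mono) auto
  finally have "a powr p \<le> a powr p * (1 - t / 2) + b powr p"
    using le by linarith
  also have "b powr p = a powr p * t powr p"
    using a t by (simp add: t_def powr_mult[symmetric])
  finally have "a powr p * (t / 2) \<le> a powr p * t powr p"
    by (simp add: algebra_simps)
  then have "t / 2 \<le> t powr p"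
    using a by simp
  also have "t powr p = t * t powr (p - 1)"
    using t by (simp add: powr_mult_base)
  finally have "t * (1 / 2) \<le> t * t powr (p - 1)"
    by simp
  then show ?thesis
    using t(1) unfolding t_def[symmetric] by (simp only: mult_le_cancel_left_pos)
qed

text \<open>The difference splits into (1 - b/a) v, of norm a - b, and b times the difference of the
  unit directions, of norm at most b/2.\<close>

lemma euclidean_norm_diff_le:
  assumes a: "euclidean_norm k v = a" and b: "euclidean_norm k w = b" and ab: "0 < b" "b \<le> a"
    and dir: "euclidean_norm k (\<lambda>i. v i / a - w i / b) \<le> 1 / 2"
  shows "euclidean_norm k (\<lambda>i. v i - w i) \<le> a - b / 2"
proof -
  have "v i - w i = (1 - b / a) * v i + b * (v i / a - w i / b)" for i
    using ab by (simp add: algebra_simps)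
  then have "euclidean_norm k (\<lambda>i. v i - w i)
      = L2_set (\<lambda>i. (1 - b / a) * v i + b * (v i / a - w i / b)) {..<k}"
    unfolding euclidean_norm_def by presburger
  also have "\<dots> \<le> L2_set (\<lambda>i. (1 - b / a) * v i) {..<k} + L2_set (\<lambda>i. b * (v i / a - w i / b)) {..<k}"
    by (rule L2_set_triangle_ineq)
  also have "\<dots> = (1 - b / a) * euclidean_norm k v + b * euclidean_norm k (\<lambda>i. v i / a - w i / b)"
    using ab unfolding euclidean_norm_def by (simp add: L2_set_right_distrib)
  also have "\<dots> \<le> (1 - b / a) * a + b * (1 / 2)"
    using ab dir a by (intro add_mono mult_left_mono) auto
  also have "\<dots> = a - b / 2"
    using ab by (simp add: field_simps)
  finally show ?thesis .
qed

lemma continuous_on_euclidean_dist [continuous_intros]: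
  assumes "continuous_on S f" "continuous_on S g"
  shows "continuous_on S (\<lambda>x. euclidean_dist k (f x) (g x))"
  unfolding euclidean_dist_def euclidean_norm_def L2_set_def
  by (intro continuous_on_real_sqrt continuous_on_sum continuous_on_power continuous_on_diff
      continuous_on_product_then_coordinatewise[OF assms(1)]
      continuous_on_product_then_coordinatewise[OF assms(2)])

text \<open>By Tychonoff the cube of sequences in [-1, 1] is compact; since the sequence space is
  first countable, the cube is also sequentially compact.\<close>

lemma bounded_sequences_convergent_subsequence:
  fixes u :: "nat \<Rightarrow> nat \<Rightarrow> real"
  assumes "\<And>n i. \<bar>u n i\<bar> \<le> 1"
  obtains l \<rho> where "strict_mono \<rho>" "(u \<circ> \<rho>) \<longlonglongrightarrow> l"
proof -
  have "compactin (product_topology (\<lambda>i::nat. euclidean) UNIV) (PiE UNIV (\<lambda>i. {-1..1::real}))"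
    by (simp add: compactin_PiE compactin_euclidean_iff)
  then have "compact (PiE UNIV (\<lambda>i::nat. {-1..1::real}))"
    by (simp add: euclidean_product_topology compactin_euclidean_iff)
  then have "seq_compact (PiE UNIV (\<lambda>i::nat. {-1..1::real}))"
    by (rule compact_imp_seq_compact)
  moreover have "\<forall>n. u n \<in> PiE UNIV (\<lambda>i. {-1..1})"
    using assms by (auto simp: abs_le_iff minus_le_iff)
  ultimately show ?thesis
    using that unfolding seq_compact_def by metis
qed

lemma snowflake_embedding_isolated:
  assumes ms: "Metric_space X d" and r: "0 < r" "r < 1" and y: "y \<in> X"
    and emb: "isometric_embedding X (snowflake r d)
                (topspace (Euclidean_space k)) (euclidean_dist k) f"
  shows "\<exists>\<delta>>0. \<forall>x\<in>X. euclidean_dist k (f x) (f y) < \<delta> \<longrightarrow> x = y"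
proof (rule ccontr)
  interpret Metric_space X d by fact
  assume "\<not> ?thesis"
  then have "\<exists>x\<in>X. euclidean_dist k (f x) (f y) < 1 / real (Suc n) \<and> x \<noteq> y" for n
    by (metis of_nat_0_less_iff zero_less_Suc zero_less_divide_1_iff)
  then obtain x where x: "\<And>n. x n \<in> X" "\<And>n. x n \<noteq> y"
    and small: "\<And>n. euclidean_dist k (f (x n)) (f y) < 1 / real (Suc n)"
    by metis
  have iso: "euclidean_dist k (f z) (f z') = d z z' powr r" if "z \<in> X" "z' \<in> X" for z z'
    using emb that by (simp add: isometric_embedding_def snowflake_def)
  define v where "v = (\<lambda>n i. f (x n) i - f y i)"
  define a where "a n = euclidean_norm k (v n)" for n
  have a: "a n = d (x n) y powr r" for n
    using iso[OF x(1) y] by (simp add: a_def v_def euclidean_dist_def)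
  have a_pos: "0 < a n" for n
    using x y by (simp add: a)
  have a_less: "a n < 1 / real (Suc n)" for n
    using small[of n] by (simp add: a_def v_def euclidean_dist_def)
  have v_le: "\<bar>v n i\<bar> \<le> a n" for n i
  proof (cases "i < k")
    case True
    have "\<bar>v n i\<bar> \<le> L2_set (\<lambda>i. \<bar>v n i\<bar>) {..<k}"
      using True by (intro member_le_L2_set) auto
    then show ?thesis
      by (simp add: a_def euclidean_norm_def L2_set_def)
  next
    \<comment> \<open>Both images vanish from index \<open>k\<close> on, so the bound holds at every
      index, as the compactness argument on whole sequences requires.\<close>
    case False
    have "f z i = 0" if "z \<in> X" for z
      using emb that False
      by (auto simp: isometric_embedding_def topspace_Euclidean_space Pi_iff)
    then show ?thesis
      using x y less_imp_le[OF a_pos] by (simp add: v_def)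
  qed
  define u where "u = (\<lambda>n i. v n i / a n)"
  have "\<bar>u n i\<bar> \<le> 1" for n i
    using v_le[of n i] a_pos[of n] by (simp add: u_def)
  then obtain l \<rho> where \<rho>: "strict_mono \<rho>" "(u \<circ> \<rho>) \<longlonglongrightarrow> l"
    by (rule bounded_sequences_convergent_subsequence)
  \<comment> \<open>The limit \<open>l\<close> is not shown to lie in
    \<open>topspace (Euclidean_space k)\<close>, so the inequality is taken from
    \<open>L2_set\<close>, which sees only coordinates below \<open>k\<close>.\<close>
  have tri: "euclidean_dist k g h \<le> euclidean_dist k g l + euclidean_dist k h l" for g h
  proof -
    have "euclidean_dist k g h \<le> euclidean_dist k g l + euclidean_dist k l h"
      unfolding euclidean_dist_def euclidean_norm_def
      using L2_set_triangle_ineq[of "\<lambda>i. g i - l i" "\<lambda>i. l i - h i" "{..<k}"] by simp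
    then show ?thesis
      by (simp add: euclidean_dist_def euclidean_norm_def L2_set_def power2_commute)
  qed
  have "isCont (\<lambda>g. euclidean_dist k g l) l"
    using continuous_on_euclidean_dist[OF continuous_on_id continuous_on_const, of UNIV k l]
    by (simp add: continuous_on_eq_continuous_at)
  then have "(\<lambda>n. euclidean_dist k ((u \<circ> \<rho>) n) l) \<longlonglongrightarrow> euclidean_dist k l l"
    using \<rho>(2) isCont_tendsto_compose by blast
  moreover have "euclidean_dist k l l = 0"
    by (simp add: euclidean_dist_def euclidean_norm_def L2_set_def)
  ultimately have ev: "\<forall>\<^sub>F n in sequentially. euclidean_dist k (u (\<rho> n)) l < 1 / 4"
    by (intro order_tendstoD(2)) auto
  then obtain m where m: "euclidean_dist k (u (\<rho> m)) l < 1 / 4"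
    by (auto dest: eventually_happens)
  define p where "p = 1 / r"
  have p: "1 < p"
    using r by (simp add: p_def)
  \<comment> \<open>Chosen so that its power \<open>p - 1\<close> is 1/4, below the bound 1/2 of
    \<open>half_le_ratio_powr\<close>.\<close>
  define \<epsilon> where "\<epsilon> = (1 / 4) powr (1 / (p - 1))"
  have \<epsilon>: "0 < \<epsilon>" "\<epsilon> \<le> 1" "\<epsilon> powr (p - 1) = 1 / 4"
    using p by (auto simp: \<epsilon>_def powr_powr intro!: powr_le1)
  have "(\<lambda>n. a (\<rho> n)) \<longlonglongrightarrow> 0"
  proof (rule tendsto_sandwich[OF _ _ tendsto_const])
    show "(\<lambda>n. 1 / real (Suc (\<rho> n))) \<longlonglongrightarrow> 0"
      using LIMSEQ_subseq_LIMSEQ[OF LIMSEQ_inverse_real_of_nat \<rho>(1)]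
      by (simp add: o_def inverse_eq_divide)
  qed (use a_pos a_less in \<open>auto intro!: always_eventually less_imp_le\<close>)
  \<comment> \<open>The index \<open>m\<close> is already fixed, so the threshold is a positive
    constant. Some \<open>n\<close> then has both a direction near \<open>l\<close> and a far
    smaller distance.\<close>
  then have "\<forall>\<^sub>F n in sequentially. a (\<rho> n) < \<epsilon> * a (\<rho> m)"
    using \<epsilon> a_pos by (intro order_tendstoD(2)) auto
  from eventually_conj[OF ev this] obtain n
    where n: "euclidean_dist k (u (\<rho> n)) l < 1 / 4" "a (\<rho> n) < \<epsilon> * a (\<rho> m)"
    by (auto dest: eventually_happens)
  define M N where "M = \<rho> m" and "N = \<rho> n"
  have le: "a N \<le> a M"
    using n(2) \<epsilon> mult_right_mono[of \<epsilon> 1 "a M"] a_pos[of M] unfolding M_def N_def by linarith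
  have "euclidean_dist k (u M) (u N) \<le> 1 / 2"
    using tri[of "u M" "u N"] m n(1) by (simp add: M_def N_def)
  then have "euclidean_norm k (\<lambda>i. v M i - v N i) \<le> a M - a N / 2"
    using le a_pos by (intro euclidean_norm_diff_le) (auto simp: a_def u_def euclidean_dist_def)
  then have c_le: "d (x M) (x N) powr r \<le> a M - a N / 2"
    using iso[OF x(1) x(1), of M N] by (simp add: v_def euclidean_dist_def)
  have "d (x M) y \<le> d (x M) (x N) + d (x N) y"
    using x y by (intro triangle)
  \<comment> \<open>Raising to the power \<open>p = 1 / r\<close> undoes the snowflake and recovers
    \<open>d\<close>.\<close>
  then have "a M powr p \<le> (d (x M) (x N) powr r) powr p + a N powr p"
    using r by (simp add: a powr_powr p_def)
  then have "1 / 2 \<le> (a N / a M) powr (p - 1)"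
    using p a_pos le c_le by (intro half_le_ratio_powr[of p _ _ "d (x M) (x N) powr r"]) auto
  also have "\<dots> \<le> \<epsilon> powr (p - 1)"
    using n(2) p a_pos[of M] a_pos[of N]
    by (intro powr_mono2) (auto simp: M_def N_def field_simps)
  finally show False
    using \<epsilon> by simp
qed

text \<open>Choosing for each point a member of a countable basis that meets \<open>S\<close> in
  that point alone gives an injection into the basis.\<close>

lemma countable_discrete:
  fixes S :: "'a::second_countable_topology set"
  assumes "discrete S"
  shows "countable S"
proof -
  obtain \<B> :: "'a set set" where \<B>: "countable \<B>" "topological_basis \<B>"
    using ex_countable_basis by blast
  have "\<exists>B\<in>\<B>. B \<inter> S = {x}" if x: "x \<in> S" for x
  proof -
    obtain T where "open T" "T \<inter> S = {x}"
      using discreteD[OF assms x] by (auto elim: isolated_inE)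
    moreover from this obtain B where "B \<in> \<B>" "x \<in> B" "B \<subseteq> T"
      using topological_basisE[OF \<B>(2), of T x] by blast
    ultimately show ?thesis
      using x by (intro bexI[of _ B]) auto
  qed
  then obtain B where B: "\<And>x. x \<in> S \<Longrightarrow> B x \<in> \<B> \<and> B x \<inter> S = {x}"
    by metis
  then have "inj_on B S"
    by (metis inj_onI singleton_inject)
  then show ?thesis
    using B \<B>(1) by (intro countable_image_inj_on[of B S] countable_subset[of "B ` S" \<B>]) auto
qed

lemma snowflake_embedding_countable:
  assumes ms: "Metric_space X d" and r: "0 < r" "r < 1"
    and emb: "isometric_embedding X (snowflake r d)
                (topspace (Euclidean_space k)) (euclidean_dist k) f"
  shows "countable X"
proof -
  interpret Metric_space X d by fact
  have iso: "euclidean_dist k (f z) (f z') = d z z' powr r" if "z \<in> X" "z' \<in> X" for z z'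
    using emb that by (simp add: isometric_embedding_def snowflake_def)
  have self: "euclidean_dist k g g = 0" for g
    by (simp add: euclidean_dist_def euclidean_norm_def L2_set_def)
  have "inj_on f X"
    using iso self by (intro inj_onI) (metis powr_eq_0_iff zero)
  moreover have "discrete (f ` X)"
  proof (rule discreteI, clarify)
    fix y assume y: "y \<in> X"
    then obtain \<delta> where \<delta>: "\<delta> > 0" "\<forall>x\<in>X. euclidean_dist k (f x) (f y) < \<delta> \<longrightarrow> x = y"
      using snowflake_embedding_isolated[OF ms r _ emb] by blast
    \<comment> \<open>This ball in the full sequence space is a cylinder over finitely many
      coordinates, hence open in the product topology.\<close>
    have "open {g. euclidean_dist k g (f y) < \<delta>}"
      by (intro open_Collect_less continuous_intros)
    moreover have "{g. euclidean_dist k g (f y) < \<delta>} \<inter> f ` X = {f y}"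
      using \<delta> y self by auto
    ultimately show "f y isolated_in f ` X"
      using y by (intro isolated_inI) auto
  qed
  ultimately show ?thesis
    using countable_discrete countable_image_inj_on by blast
qed

text \<open>Singletons cover \<open>X\<close> and have diameter 0, hence weight 0 because
  \<open>s\<close> is positive; at \<open>s = 0\<close> each would weigh 1.\<close>

lemma hausdorff_measure_countable:
  assumes "countable X" "\<And>x. x \<in> X \<Longrightarrow> d x x = 0" "0 < s"
  shows "hausdorff_measure X d s = 0"
proof -
  \<comment> \<open>For finite \<open>X\<close> the enumeration repeats points, which is harmless as
    every member has weight 0.\<close>
  define U where "U i = (if X = {} then {} else {from_nat_into X i})" for i
  have U: "U i \<subseteq> X" "ediam d (U i) = 0" for i
    using assms(2)[OF from_nat_into[of X i]] from_nat_into[of X i]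
    by (auto simp: U_def ediam_def bot_ennreal)
  have "X \<subseteq> (\<Union>i. U i)"
    using from_nat_into_surj[OF assms(1)] by (fastforce simp: U_def)
  then have cover: "U \<in> delta_covers X d \<delta>" for \<delta>
    using U by (simp add: delta_covers_def)
  have "hausdorff_premeasure X d s \<delta> \<le> (\<Sum>i. diam_pow d s (U i))" for \<delta>
    unfolding hausdorff_premeasure_def using cover by (rule INF_lower)
  moreover have "diam_pow d s (U i) = 0" for i
    using U assms(3) by (simp add: diam_pow_def)
  ultimately have "hausdorff_premeasure X d s \<delta> = 0" for \<delta>
    by simp
  then show ?thesis
    by (simp add: hausdorff_measure_def)
qed

text \<open>The measure at exponent 0 need not vanish, so the infimum is bounded by every positive
  exponent instead.\<close>

lemma hausdorff_dim_countable:
  assumes "countable X" "\<And>x. x \<in> X \<Longrightarrow> d x x = 0"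
  shows "hausdorff_dim X d = 0"
proof -
  have "hausdorff_dim X d \<le> ennreal s" if "0 < s" for s
    unfolding hausdorff_dim_def
    using hausdorff_measure_countable[where d = d and X = X and s = s] assms that
    by (intro INF_lower) auto
  then have "hausdorff_dim X d \<le> 0 + ennreal s" if "0 < s" for s
    using that by simp
  then have "hausdorff_dim X d \<le> 0"
    by (rule ennreal_le_epsilon)
  then show ?thesis
    by simp
qed

theorem theorem1p2:
  fixes X :: "'a set" and d :: "'a \<Rightarrow> 'a \<Rightarrow> real" and r :: real
  assumes "Metric_space X d"
    and "hausdorff_dim X d > 0"
    and "0 < r" and "r < 1"
  shows "\<not> (\<exists>(k::nat) f. isometric_embedding X (snowflake r d)
                          (topspace (Euclidean_space k)) (euclidean_dist k) f)"
proof
  assume "\<exists>(k::nat) f. isometric_embedding X (snowflake r d)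
                         (topspace (Euclidean_space k)) (euclidean_dist k) f"
  then have "countable X"
    using snowflake_embedding_countable assms(1,3,4) by blast
  then have "hausdorff_dim X d = 0"
    using Metric_space.mdist_zero[OF assms(1)] by (rule hausdorff_dim_countable)
  with assms(2) show False
    by simp
qed

end
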